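(* Let $(S,\mathcal F,\mathcal S,\mathrm E,P)$ be a quintuplet satisfying conditions C1--C5 and axioms A1, A2, A3 (as listed in the context). Let $n\ge 1$ and let $X=(X_1,\ldots,X_n):S\to\mathbb R^n$, where $X_i\in\mathcal S$ for all $i$. Then $\mathrm E X:=(\mathrm E X_1,\ldots,\mathrm E X_n)$ belongs to the convex hull of the set $X(S)=\{X(t) : t\in S\}\subset\mathbb R^n$.
   Context: Setting. $S$ is an arbitrary nonempty set, $\mathcal F$ is an algebra of subsets of $S$ (it contains $S$ and is closed under finite set operations; it may be a sigma-algebra), $\mathcal S$ is a family of functions $X:S\to\mathbb R$ (not assumed bounded), $\mathrm E:\mathcal S\to\mathbb R$ is a functional, and $P$ is the set function $P(B)=\mathrm E(I_B)$, $B\in\mathcal F$, where $I_B$ is the indicator function of $B$. Notation such as $P(X=0)$ means $P(\{s\in S: X(s)=0\})$, and $I_{X\in J}$ is the indicator of $\{s\in S: X(s)\in J\}$. "Interval" means any interval of $\mathbb R$, bounded or unbounded. Conditions: C1: if $X_1,X_2\in\mathcal S$ then $aX_1+bX_2\in\mathcal S$ for all $a,b\in\mathbb R$. C2: for $B\in\mathcal F$, $I_B\in\mathcal S$. C3: for $X\in\mathcal S$ and any interval $J$, the set $\{s\in S: X(s)\in J\}$ is in $\mathcal F$. C4: for $X\in\mathcal S$ with $X(s)\ge 0$ for all $s\in S$, $X\cdot I_{X\in J}\in\mathcal S$ for any interval $J$. C5: if $X\in\mathcal S$, $N\in\mathcal F$ and $P(N)=0$, then $X\cdot I_N\in\mathcal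 S$ and $\mathrm E(X\cdot I_N)=0$. Axioms: A1: $\mathrm E c=c$ for any constant $c$. A2: $\mathrm E\left(\sum_{i=1}^m\alpha_iX_i\right)=\sum_{i=1}^m\alpha_i\mathrm E(X_i)$ for $\alpha_i\in\mathbb R$, $X_i\in\mathcal S$. A3: for $X\in\mathcal S$, if $\mathrm E X=0$ then either $P(X=0)=1$ or there exist $s_1,s_2\in S$ such that $X(s_1)X(s_2)<0$ (inclusive "or"). *)

theory Defs
  imports "HOL-Analysis.Analysis"
begin

text \<open>
  A function \<open>S \<rightarrow> \<real>\<close> is represented by the unique total function that agrees with it on \<open>S\<close>
  and is \<open>undefined\<close> off \<open>S\<close> (an element of \<open>S \<rightarrow>\<^sub>E UNIV\<close>), so that equality of functions means
  equality on \<open>S\<close>. The functional \<open>E\<close> is meaningful only on \<open>L\<close>, and \<open>P\<close> only on \<open>F\<close>.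
\<close>

definition ind :: "'a set \<Rightarrow> 'a set \<Rightarrow> 'a \<Rightarrow> real" where
  "ind S B = (\<lambda>s\<in>S. indicator B s)"

text \<open>
  For sets of reals, \<^const>\<open>is_interval\<close> describes all intervals: open, closed or half-open,
  bounded or unbounded, including singletons and the empty set.
\<close>

locale expectation_quintuplet =
  fixes S :: "'a set"
    and F :: "'a set set"
    and L :: "('a \<Rightarrow> real) set"
    and E :: "('a \<Rightarrow> real) \<Rightarrow> real"
    and P :: "'a set \<Rightarrow> real"
  assumes S_nonempty: "S \<noteq> {}"
    and F_algebra: "algebra S F"
    and L_functions: "L \<subseteq> S \<rightarrow>\<^sub>E UNIV"
    and P_eq: "\<And>B. B \<in> F \<Longrightarrow> P B = E (ind S B)"
    and C1: "\<And>X Y a b. X \<in> L \<Longrightarrow> Y \<in> L \<Longrightarrow> (\<lambda>s\<in>S. a * X s + b * Y s) \<in> L"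
    and C2: "\<And>B. B \<in> F \<Longrightarrow> ind S B \<in> L"
    and C3: "\<And>X J. X \<in> L \<Longrightarrow> is_interval J \<Longrightarrow> {s \<in> S. X s \<in> J} \<in> F"
    and C4: "\<And>X J. X \<in> L \<Longrightarrow> (\<forall>s\<in>S. 0 \<le> X s) \<Longrightarrow> is_interval J \<Longrightarrow>
               (\<lambda>s\<in>S. X s * ind S {t \<in> S. X t \<in> J} s) \<in> L"
    and C5: "\<And>X N. X \<in> L \<Longrightarrow> N \<in> F \<Longrightarrow> P N = 0 \<Longrightarrow>
               (\<lambda>s\<in>S. X s * ind S N s) \<in> L \<and> E (\<lambda>s\<in>S. X s * ind S N s) = 0"
    and A1: "\<And>c. E (\<lambda>s\<in>S. c) = c"
    and A2: "\<And>(m::nat) \<alpha> X. 1 \<le> m \<Longrightarrow> (\<forall>i\<in>{1..m}. X i \<in> L) \<Longrightarrow>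
               E (\<lambda>s\<in>S. \<Sum>i=1..m. \<alpha> i * X i s) = (\<Sum>i=1..m. \<alpha> i * E (X i))"
    and A3: "\<And>X. X \<in> L \<Longrightarrow> E X = 0 \<Longrightarrow>
               P {s \<in> S. X s = 0} = 1 \<or> (\<exists>s1\<in>S. \<exists>s2\<in>S. X s1 * X s2 < 0)"

end

theory Submission
  imports Defs
begin

text \<open>
  After centring, assume \<open>E X = 0\<close>. If \<open>0\<close> is not in the convex hull of \<open>X(S)\<close>, separate: there is
  a nonzero \<open>a\<close> in the span of \<open>X(S)\<close> with \<open>Y = a \<bullet> X \<ge> 0\<close>. Since \<open>E Y = 0\<close>, A3 forces \<open>Y = 0\<close>
  outside a set \<open>N\<close> with \<open>P N = 0\<close>. Redefining \<open>X\<close> on \<open>N\<close> to be a constant value that \<open>X\<close> takes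
  outside \<open>N\<close> keeps the expectation, by C5, and shrinks the range to a subset lying in the
  hyperplane orthogonal to \<open>a\<close>, so one concludes by induction on the dimension of the span of the range.
\<close>

context expectation_quintuplet
begin

lemma E_lincomb:
  assumes "X \<in> L" "Y \<in> L"
  shows "E (\<lambda>s\<in>S. a * X s + b * Y s) = a * E X + b * E Y"
proof -
  have "{1..2::nat} = {1, 2}" by auto
  then show ?thesis
    using A2[of 2 "\<lambda>i. if i = 1 then X else Y" "\<lambda>i. if i = 1 then a else b"] assms
    by simp
qed

lemma zero_in_L: "(\<lambda>s\<in>S. 0) \<in> L"
proof -
  interpret algebra S F by (rule F_algebra)
  have "ind S {} \<in> L" using C2 by blast
  then show ?thesis using C1[of "ind S {}" "ind S {}" 0 0] by (simp cong: restrict_cong)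
qed

text \<open>A2 is stated for sums over \<open>{1..m}\<close>; induction from the two-term case
  carries it to any finite index set, here the coordinates \<open>'n\<close>, and C1 gives
  membership in \<open>L\<close> along the way.\<close>

lemma sum_in_L:
  assumes "finite I" "\<And>i. i \<in> I \<Longrightarrow> X i \<in> L"
  shows "(\<lambda>s\<in>S. \<Sum>i\<in>I. a i * X i s) \<in> L
       \<and> E (\<lambda>s\<in>S. \<Sum>i\<in>I. a i * X i s) = (\<Sum>i\<in>I. a i * E (X i))"
  using assms
proof (induction I)
  case empty
  then show ?case using zero_in_L A1[of 0] by (simp del: restrict_apply)
next
  case (insert j I)
  let ?Z = "\<lambda>s\<in>S. \<Sum>i\<in>I. a i * X i s"
  have Z: "?Z \<in> L" "E ?Z = (\<Sum>i\<in>I. a i * E (X i))" using insert.IH insert.prems by blast+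
  have eq: "(\<lambda>s\<in>S. \<Sum>i\<in>insert j I. a i * X i s) = (\<lambda>s\<in>S. a j * X j s + 1 * ?Z s)"
    using insert.hyps by (auto intro!: restrict_ext)
  have Xj: "X j \<in> L" using insert.prems by simp
  show ?case
    unfolding eq
    using C1[OF Xj Z(1), of "a j" 1] E_lincomb[OF Xj Z(1), of "a j" 1] Z(2) insert.hyps
    by (simp del: restrict_apply)
qed

lemma one_in_L: "(\<lambda>s\<in>S. 1) \<in> L"
proof -
  interpret algebra S F by (rule F_algebra)
  have "ind S S = (\<lambda>s\<in>S. 1)" by (auto simp: ind_def intro!: restrict_ext)
  then show ?thesis using C2[OF top] by simp
qed

lemma P_empty: "P {} = 0"
proof -
  interpret algebra S F by (rule F_algebra)
  show ?thesis using P_eq[of "{}"] A1[of 0] by (simp add: ind_def)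
qed

lemma P_compl:
  assumes "B \<in> F"
  shows "P (S - B) = 1 - P B"
proof -
  interpret algebra S F by (rule F_algebra)
  have "ind S (S - B) = (\<lambda>s\<in>S. 1 * (\<lambda>s\<in>S. 1) s + (-1) * ind S B s)"
    by (auto simp: ind_def indicator_def intro!: restrict_ext)
  then have "E (ind S (S - B)) = 1 - E (ind S B)"
    using E_lincomb[OF one_in_L C2[OF assms], of 1 "-1"] A1[of 1] by simp
  then show ?thesis using P_eq assms compl_sets by simp
qed

text \<open>The new function is \<open>X\<close> plus the correction \<open>?D\<close>, which is -X
  + c on \<open>N\<close> and 0 elsewhere. Both parts of \<open>?D\<close> have expectation 0: the
  first by C5, the second because \<open>E (ind S N)\<close> is \<open>P N\<close>.\<close>

lemma modify_on_null:
  assumes X: "X \<in> L" and N: "N \<in> F" "P N = 0"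
  shows "(\<lambda>s\<in>S. if s \<in> N then c else X s) \<in> L"
    and "E (\<lambda>s\<in>S. if s \<in> N then c else X s) = E X"
proof -
  let ?XN = "\<lambda>s\<in>S. X s * ind S N s"
  let ?D = "\<lambda>s\<in>S. (-1) * ?XN s + c * ind S N s"
  have XN: "?XN \<in> L" "E ?XN = 0" using C5[OF X N] by auto
  have I: "ind S N \<in> L" "E (ind S N) = 0" using C2 P_eq N by auto
  have D: "?D \<in> L" "E ?D = 0"
    using C1[OF XN(1) I(1)] E_lincomb[OF XN(1) I(1), of "-1" c] XN I by (blast, simp)
  have eq: "(\<lambda>s\<in>S. if s \<in> N then c else X s) = (\<lambda>s\<in>S. 1 * X s + 1 * ?D s)"
    by (auto simp: ind_def intro!: restrict_ext)
  show "(\<lambda>s\<in>S. if s \<in> N then c else X s) \<in> L"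
    unfolding eq by (rule C1[OF X D(1)])
  show "E (\<lambda>s\<in>S. if s \<in> N then c else X s) = E X"
    unfolding eq using E_lincomb[OF X D(1), of 1 1] D(2) by simp
qed

lemma null_if_nonneg:
  assumes Y: "Y \<in> L" "E Y = 0" and nonneg: "\<And>s. s \<in> S \<Longrightarrow> 0 \<le> Y s"
  shows "{s \<in> S. Y s \<noteq> 0} \<in> F" "P {s \<in> S. Y s \<noteq> 0} = 0" "\<exists>s\<in>S. Y s = 0"
proof -
  interpret algebra S F by (rule F_algebra)
  \<comment> \<open>The singleton {0} is a degenerate interval, so C3 applies.\<close>
  have Z: "{s \<in> S. Y s = 0} \<in> F"
    using C3[OF Y(1), of "{0}"] by (simp add: is_interval_1)
  have P1: "P {s \<in> S. Y s = 0} = 1"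
    using A3[OF Y] nonneg by (meson mult_nonneg_nonneg not_less)
  have eq: "{s \<in> S. Y s \<noteq> 0} = S - {s \<in> S. Y s = 0}" by auto
  show "{s \<in> S. Y s \<noteq> 0} \<in> F" unfolding eq using Z by auto
  show "P {s \<in> S. Y s \<noteq> 0} = 0" unfolding eq using P_compl[OF Z] P1 by simp
  show "\<exists>s\<in>S. Y s = 0"
  proof (rule ccontr)
    assume "\<not> ?thesis"
    then have "{s \<in> S. Y s = 0} = {}" by auto
    then have "P {} = 1" using P1 by (rule subst)
    then show False using P_empty by simp
  qed
qed

text \<open>Inducting on the dimension of the span keeps the number of coordinates fixed, so the
  type \<open>'n\<close> never changes. Dimension 0 needs no separate case: the range is then
  {0}.\<close>

lemma zero_in_convex_hull_range:
  fixes X :: "'n::finite \<Rightarrow> 'a \<Rightarrow> real"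
  assumes "\<And>i. X i \<in> L" "\<And>i. E (X i) = 0"
  shows "0 \<in> convex hull ((\<lambda>t. \<chi> i. X i t) ` S)"
  using assms
proof (induction "dim ((\<lambda>t. \<chi> i. X i t) ` S)" arbitrary: X rule: less_induct)
  case less
  let ?R = "(\<lambda>t. \<chi> i. X i t) ` S"
  show ?case
  proof (rule ccontr)
    assume not0: "0 \<notin> convex hull ?R"
    have "convex hull ?R \<noteq> {}" using S_nonempty by simp
    \<comment> \<open>Taking \<open>a\<close> inside the span is what makes the dimension drop
      later; otherwise \<open>a\<close> could be orthogonal to the whole range.\<close>
    then obtain a where a: "a \<in> span (convex hull ?R)" "a \<noteq> 0"
      and pos: "\<And>x. x \<in> convex hull ?R \<Longrightarrow> 0 \<le> a \<bullet> x"
      using separating_hyperplane_set_0_inspan[OF convex_convex_hull _ not0] by blast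
    define Y where "Y = (\<lambda>s\<in>S. \<Sum>i\<in>UNIV. a $ i * X i s)"
    have Y: "Y \<in> L" "E Y = 0"
      using sum_in_L[of UNIV X "\<lambda>i. a $ i"] less.prems unfolding Y_def by auto
    have Y_inner: "Y s = a \<bullet> (\<chi> i. X i s)" if "s \<in> S" for s
      using that by (simp add: Y_def inner_vec_def)
    have Y_nonneg: "0 \<le> Y s" if "s \<in> S" for s
      using pos[of "\<chi> i. X i s"] that by (simp add: Y_inner hull_inc)
    define N where "N = {s \<in> S. Y s \<noteq> 0}"
    note N = null_if_nonneg[OF Y Y_nonneg, folded N_def]
    obtain s0 where s0: "s0 \<in> S" "Y s0 = 0" using N(3) by blast
    \<comment> \<open>The same \<open>s0\<close> serves every coordinate, so on \<open>N\<close> the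
      new vector is the genuine value of \<open>X\<close> at \<open>s0\<close>.\<close>
    define X' where "X' i = (\<lambda>s\<in>S. if s \<in> N then X i s0 else X i s)" for i
    have X': "X' i \<in> L" "E (X' i) = 0" for i
      using modify_on_null[OF less.prems(1) N(1,2)] less.prems(2) by (simp_all add: X'_def)
    let ?R' = "(\<lambda>t. \<chi> i. X' i t) ` S"
    have R': "x \<in> ?R \<and> a \<bullet> x = 0" if x: "x \<in> ?R'" for x
    proof -
      obtain t where t: "t \<in> S" "x = (\<chi> i. X' i t)" using x by blast
      define t' where "t' = (if t \<in> N then s0 else t)"
      have t': "t' \<in> S" "Y t' = 0" using t s0 by (auto simp: t'_def N_def)
      have "x = (\<chi> i. X i t')" using t by (simp add: X'_def t'_def vec_eq_iff)
      then show ?thesis using t' Y_inner by auto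
    qed
    have "convex hull ?R \<subseteq> span ?R" by (rule convex_hull_subset_span)
    then have a_span: "a \<in> span ?R" using a(1) span_mono span_span by blast
    have "span ?R' \<subseteq> span ?R" using R' by (intro span_mono) blast
    \<comment> \<open>Otherwise \<open>a\<close> would be orthogonal to itself; thus
      \<open>a\<close> witnesses that the inclusion of spans is strict.\<close>
    moreover have "a \<notin> span ?R'"
    proof
      assume "a \<in> span ?R'"
      moreover have "span ?R' \<subseteq> {x. a \<bullet> x = 0}"
        using R' by (intro span_minimal subspace_hyperplane) auto
      ultimately show False using a(2) by auto
    qed
    ultimately have "dim ?R' < dim ?R" using a_span by (intro dim_psubset) blast
    then have "0 \<in> convex hull ?R'" using less.hyps X' by blast
    moreover have "convex hull ?R' \<subseteq> convex hull ?R" using R' by (intro hull_mono) blast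
    ultimately show False using not0 by blast
  qed
qed

end

theorem theorem2p10:
  fixes S :: "'a set"
    and F :: "'a set set"
    and L :: "('a \<Rightarrow> real) set"
    and E :: "('a \<Rightarrow> real) \<Rightarrow> real"
    and P :: "'a set \<Rightarrow> real"
    and X :: "'n::finite \<Rightarrow> 'a \<Rightarrow> real"
  assumes "expectation_quintuplet S F L E P"
    and "\<And>i. X i \<in> L"
  shows "(\<chi> i. E (X i)) \<in> convex hull ((\<lambda>t. \<chi> i. X i t) ` S)"
proof -
  interpret expectation_quintuplet S F L E P by fact
  \<comment> \<open>Centring: the mean is subtracted as a multiple of the constant function 1, to
    match the shape of C1.\<close>
  define Z where "Z i = (\<lambda>s\<in>S. 1 * X i s + (- E (X i)) * (\<lambda>s\<in>S. 1) s)" for i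
  let ?m = "\<chi> i. E (X i)"
  let ?R = "(\<lambda>t. \<chi> i. X i t) ` S"
  have "Z i \<in> L" for i
    unfolding Z_def by (rule C1[OF assms(2) one_in_L])
  moreover have "E (Z i) = 0" for i
    unfolding Z_def using E_lincomb[OF assms(2) one_in_L, of 1 i "- E (X i)"] A1[of 1]
    by (simp del: restrict_apply)
  ultimately have "0 \<in> convex hull ((\<lambda>t. \<chi> i. Z i t) ` S)"
    by (rule zero_in_convex_hull_range)
  \<comment> \<open>Centring translates the range by \<open>- ?m\<close>, and convex hulls commute
    with translations.\<close>
  moreover have "(\<lambda>t. \<chi> i. Z i t) ` S = (\<lambda>x. - ?m + x) ` ?R"
    unfolding image_image by (intro image_cong) (auto simp: Z_def vec_eq_iff)
  ultimately have "0 \<in> (\<lambda>x. - ?m + x) ` (convex hull ?R)"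
    by (simp only: convex_hull_translation)
  then obtain y where "y \<in> convex hull ?R" "0 = - ?m + y" by blast
  then show ?thesis by (simp add: eq_neg_iff_add_eq_0)
qed

end
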